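(* Let $n>1$ be an integer, and let $T$ be a tree with $n+1$ vertices $v_1,\ldots,v_{n+1}$, where $v_1$ and $v_{n+1}$ are two leaves of $T$. Assign to each edge $e$ of $T$ a weight $w(e)\in\mathbb{Z}$. Then $$\det\left[x+d(v_{j+1},v_k)\right]_{1\leq j,k\leq n}=2^{n-2}\prod_{e\in E(T)}w(e).$$
   Context: Here $x$ is a variable (indeterminate). Trees are finite and undirected; $E(T)$ denotes the edge set of $T$. A leaf of a tree is a vertex of degree one. For vertices $u,v$ of the weighted tree $T$, the weighted distance $d(u,v)$ is the sum of the weights $w(e)$ of all edges $e$ in the unique path from $u$ to $v$ in $T$ (so $d(v,v)=0$). In $[a_{jk}]_{1\leq j,k\leq n}$, $j$ is the row index and $k$ the column index. *)

theory Defs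
  imports "Jordan_Normal_Form.Determinant"
begin

text \<open>
  A graph is a pair of a vertex set and a set of edges, each edge being an
  unordered pair of distinct vertices.
\<close>

definition simple_graph :: "'a set \<Rightarrow> 'a set set \<Rightarrow> bool" where
  "simple_graph V E \<longleftrightarrow> finite V \<and> (\<forall>e\<in>E. e \<subseteq> V \<and> card e = 2)"

definition is_path :: "'a set \<Rightarrow> 'a set set \<Rightarrow> 'a \<Rightarrow> 'a \<Rightarrow> 'a list \<Rightarrow> bool" where
  "is_path V E u v p \<longleftrightarrow>
     p \<noteq> [] \<and> hd p = u \<and> last p = v \<and> set p \<subseteq> V \<and> distinct p \<and>
     successively (\<lambda>a b. {a, b} \<in> E) p"

text \<open>The closing edge of the cycle joins the last vertex to the first.\<close>

definition is_cycle :: "'a set \<Rightarrow> 'a set set \<Rightarrow> 'a list \<Rightarrow> bool" where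
  "is_cycle V E c \<longleftrightarrow>
     length c \<ge> 3 \<and> set c \<subseteq> V \<and> distinct c \<and>
     successively (\<lambda>a b. {a, b} \<in> E) c \<and> {last c, hd c} \<in> E"

definition is_tree :: "'a set \<Rightarrow> 'a set set \<Rightarrow> bool" where
  "is_tree V E \<longleftrightarrow>
     simple_graph V E \<and> V \<noteq> {} \<and>
     (\<forall>u\<in>V. \<forall>v\<in>V. \<exists>p. is_path V E u v p) \<and>
     (\<nexists>c. is_cycle V E c)"

definition is_leaf :: "'a set \<Rightarrow> 'a set set \<Rightarrow> 'a \<Rightarrow> bool" where
  "is_leaf V E u \<longleftrightarrow> u \<in> V \<and> card {e \<in> E. u \<in> e} = 1"

definition path_edges :: "'a list \<Rightarrow> 'a set set" where
  "path_edges p = {{p ! i, p ! Suc i} | i. Suc i < length p}"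

text \<open>Meaningful only where the path is unique, as between two vertices of a tree.\<close>

definition wdist :: "'a set \<Rightarrow> 'a set set \<Rightarrow> ('a set \<Rightarrow> int) \<Rightarrow> 'a \<Rightarrow> 'a \<Rightarrow> int" where
  "wdist V E w u v = (\<Sum>e\<in>path_edges (THE p. is_path V E u v p). w e)"

text \<open>
  Matrices of type \<open>'a mat\<close> are indexed from 0, so the entry at \<open>(j, k)\<close> below is the
  usual one in row \<open>j + 1\<close> and column \<open>k + 1\<close>, namely \<open>x + d(v\<^sub>j\<^sub>+\<^sub>2, v\<^sub>k\<^sub>+\<^sub>1)\<close>.
  The indeterminate \<open>x\<close> is \<open>[:0, 1:]\<close> in \<open>\<int>[x]\<close>.
\<close>

definition shifted_dist_mat ::
  "'a set \<Rightarrow> 'a set set \<Rightarrow> ('a set \<Rightarrow> int) \<Rightarrow> (nat \<Rightarrow> 'a) \<Rightarrow> nat \<Rightarrow> int poly mat" where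
  "shifted_dist_mat V E w v n =
     mat n n (\<lambda>(j, k). [:0, 1:] + of_int (wdist V E w (v (j + 2)) (v (k + 1))))"

end

theory Submission
  imports Defs
begin

text \<open>
  Let \<open>a = v\<^sub>1\<close> and \<open>b = v\<^sub>n\<^sub>+\<^sub>1\<close>. Order the vertices other than \<open>a\<close> as \<open>b, y\<^sub>1, y\<^sub>2, \<dots>\<close> so that
  each one is attached to a single earlier neighbour. Moving the column of \<open>a\<close> into the place of
  the missing column of \<open>b\<close> costs the sign \<open>(-1)\<^bsup>n-1\<^esup>\<close>, and subtracting from it the column of the
  neighbour of \<open>a\<close> leaves the constant column \<open>w\<close>, the weight of the edge at \<open>a\<close>. There remains the
  determinant of the matrix whose column \<open>b\<close> consists of ones and whose other entries are
  \<open>x + d(y, z)\<close>. If \<open>t\<close> is the last vertex, attached to \<open>s\<close> by an edge of weight \<open>w\<close>, then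
  \<open>d(t, y) = d(s, y) + w\<close> for every earlier \<open>y\<close>; subtracting row \<open>s\<close> from row \<open>t\<close>, then column \<open>s\<close> and
  \<open>w\<close> times the column of ones from column \<open>t\<close>, splits off the factor \<open>-2w\<close>. Since \<open>b\<close> is a leaf,
  \<open>s\<close> differs from \<open>b\<close> until only two vertices are left, and there the factor is \<open>-w\<close>.
\<close>

section \<open>Determinants\<close>

lemma det_multcol:
  assumes "k < n" "A \<in> carrier_mat n n"
  shows "det (multcol k a A) = a * det (A :: 'r :: comm_ring_1 mat)"
proof -
  have "multcol k a A = transpose_mat (multrow k a (transpose_mat A))"
    using assms by (intro eq_matI) auto
  moreover have "det (transpose_mat (multrow k a (transpose_mat A))) = a * det A"
    using assms by (subst det_transpose[of _ n]) (auto simp: det_multrow[of _ n] det_transpose[of _ n])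
  ultimately show ?thesis by simp
qed

lemma det_permute_cols:
  assumes "A \<in> carrier_mat n n" "p permutes {0..<n}"
  shows "det (mat n n (\<lambda>(i, j). A $$ (i, p j))) = signof p * det (A :: 'r :: comm_ring_1 mat)"
proof -
  have "mat n n (\<lambda>(i, j). A $$ (i, p j))
      = transpose_mat (mat n n (\<lambda>(i, j). transpose_mat A $$ (p i, j)))"
    using assms permutes_in_image[OF assms(2)] by (intro eq_matI) auto
  also have "det \<dots> = det (mat n n (\<lambda>(i, j). transpose_mat A $$ (p i, j)))"
    by (rule det_transpose[of _ n]) simp
  also have "\<dots> = signof p * det A"
    using assms by (simp add: det_permute_rows[of _ n] det_transpose[of _ n])
  finally show ?thesis .
qed

text \<open>Passing from \<open>g\<close> to \<open>h\<close> permutes rows and columns alike, so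
  the sign enters twice and cancels. This permits replacing the given numbering of the vertices by
  one adapted to the tree.\<close>

lemma det_reindex:
  fixes f :: "'a \<Rightarrow> 'a \<Rightarrow> 'r :: comm_ring_1"
  assumes g: "bij_betw g {0..<n} S" and h: "bij_betw h {0..<n} S"
  shows "det (mat n n (\<lambda>(i, j). f (g i) (g j))) = det (mat n n (\<lambda>(i, j). f (h i) (h j)))"
proof -
  define p where "p i = (if i < n then inv_into {0..<n} g (h i) else i)" for i
  have "bij_betw (inv_into {0..<n} g \<circ> h) {0..<n} {0..<n}"
    using h bij_betw_inv_into[OF g] by (rule bij_betw_trans)
  hence "bij_betw p {0..<n} {0..<n}"
    by (subst bij_betw_cong[where g = "inv_into {0..<n} g \<circ> h"]) (auto simp: p_def)
  hence p: "p permutes {0..<n}"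
    by (rule bij_imp_permutes) (auto simp: p_def)
  have gp: "g (p i) = h i" if "i < n" for i
  proof -
    have "h i \<in> g ` {0..<n}"
      using that g h by (auto simp: bij_betw_def)
    thus ?thesis by (simp add: p_def that f_inv_into_f)
  qed
  have pn: "p i < n" if "i < n" for i
    using permutes_in_image[OF p, of i] that by simp
  let ?A = "mat n n (\<lambda>(i, j). f (g i) (g j))"
  let ?B = "mat n n (\<lambda>(i, j). ?A $$ (p i, j))"
  have "mat n n (\<lambda>(i, j). f (h i) (h j)) = mat n n (\<lambda>(i, j). ?B $$ (i, p j))"
    by (intro eq_matI) (auto simp: pn gp)
  also have "det \<dots> = signof p * det ?B"
    by (rule det_permute_cols[OF _ p]) simp
  also have "det ?B = signof p * det ?A"
    by (rule det_permute_rows[OF _ p]) simp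
  also have "signof p * (signof p * det ?A) = det ?A"
    by (simp add: sign_def)
  finally show ?thesis ..
qed

text \<open>Expanding the left matrix along its first column and the right one along its last column
  meets the same entries and minors. The cofactor signs differ by
  \<open>(- 1) ^ (n - 1)\<close>.\<close>

lemma det_rotate_cols:
  fixes f :: "nat \<Rightarrow> nat \<Rightarrow> 'r :: comm_ring_1"
  assumes "n > 0"
  shows "det (mat n n (\<lambda>(i, j). f i j))
       = (- 1) ^ (n - 1) * det (mat n n (\<lambda>(i, j). f i (if Suc j = n then 0 else Suc j)))"
    (is "det ?A = _ * det ?B")
proof -
  have "cofactor ?A i 0 = (- 1) ^ (n - 1) * cofactor ?B i (n - 1)" if "i < n" for i
  proof -
    have "mat_delete ?A i 0 = mat_delete ?B i (n - 1)"
      by (intro eq_matI) (use assms that in \<open>auto simp: mat_delete_def\<close>)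
    moreover have "(- 1) ^ (n - 1) * ((- 1) ^ (i + (n - 1)) :: 'r) = (- 1) ^ i"
      by (simp flip: power_add add: minus_one_power_iff)
    ultimately show ?thesis
      by (simp add: cofactor_def flip: mult.assoc)
  qed
  hence "(\<Sum>i<n. ?A $$ (i, 0) * cofactor ?A i 0)
       = (- 1) ^ (n - 1) * (\<Sum>i<n. ?B $$ (i, n - 1) * cofactor ?B i (n - 1))"
    using assms by (auto simp: sum_distrib_left mult_ac intro!: sum.cong)
  moreover have "det ?A = (\<Sum>i<n. ?A $$ (i, 0) * cofactor ?A i 0)"
    using assms by (intro laplace_expansion_column) auto
  moreover have "det ?B = (\<Sum>i<n. ?B $$ (i, n - 1) * cofactor ?B i (n - 1))"
    using assms by (intro laplace_expansion_column) auto
  ultimately show ?thesis by simp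
qed

text \<open>Only the column of the first vertex is replaced by ones; its row stays, so the matrix
  remains square and is not symmetric in general.\<close>

definition bordered_mat :: "('a \<Rightarrow> 'a \<Rightarrow> 'r :: comm_ring_1) \<Rightarrow> 'a list \<Rightarrow> 'r mat" where
  "bordered_mat D ys = mat (length ys) (length ys)
     (\<lambda>(i, j). if j = 0 then 1 else D (ys ! i) (ys ! j))"

text \<open>The new vertex \<open>t\<close> is a copy of its parent \<open>ys ! p\<close> at extra
  distance \<open>w\<close>, so subtracting the parent leaves almost constant rows and columns. The
  parent needs a genuine distance column, hence \<open>0 < p\<close>. The diagonal is only compared,
  not set to zero, because it equals \<open>x\<close> in the application.\<close>

lemma det_bordered_mat_snoc:
  fixes D :: "'a \<Rightarrow> 'a \<Rightarrow> 'r :: comm_ring_1"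
  assumes p: "0 < p" "p < length ys"
    and sym: "\<And>y. y \<in> set ys \<Longrightarrow> D y t = D t y"
    and diag: "D t t = D (ys ! p) (ys ! p)"
    and step: "\<And>y. y \<in> set ys \<Longrightarrow> D t y = D (ys ! p) y + w"
    and sym': "\<And>y. y \<in> set ys \<Longrightarrow> D y (ys ! p) = D (ys ! p) y"
  shows "det (bordered_mat D (ys @ [t])) = - 2 * w * det (bordered_mat D ys)"
proof -
  define m where "m = length ys"
  define A where "A = bordered_mat D (ys @ [t])"
  define A1 where "A1 = addrow (- 1) m p A"
  define A2 where "A2 = addcol (- 1) m p A1"
  define A3 where "A3 = addcol (- w) m 0 A2"
  have [simp]: "A \<in> carrier_mat (Suc m) (Suc m)"
    by (simp add: A_def bordered_mat_def m_def)
  have [simp]: "dim_row A = Suc m" "dim_col A = Suc m"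
    by (simp_all add: A_def bordered_mat_def m_def)
  have [simp]: "A1 \<in> carrier_mat (Suc m) (Suc m)" "dim_row A1 = Suc m" "dim_col A1 = Suc m"
    by (simp_all add: A1_def)
  have [simp]: "A2 \<in> carrier_mat (Suc m) (Suc m)" "dim_row A2 = Suc m" "dim_col A2 = Suc m"
    by (simp_all add: A2_def mat_addcol_def)
  have [simp]: "A3 \<in> carrier_mat (Suc m) (Suc m)" "dim_row A3 = Suc m" "dim_col A3 = Suc m"
    by (simp_all add: A3_def mat_addcol_def)
  have pm: "p < m" using p by (simp add: m_def)
  have A: "A $$ (i, j) = (if j = 0 then 1 else D ((ys @ [t]) ! i) ((ys @ [t]) ! j))"
    if "i \<le> m" "j \<le> m" for i j
    using that by (simp add: A_def bordered_mat_def m_def)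
  have nth: "(ys @ [t]) ! i = (if i = m then t else ys ! i)" if "i \<le> m" for i
    using that by (auto simp: nth_append m_def)
  have mem: "ys ! i \<in> set ys" if "i < m" for i
    using that by (simp add: m_def)
  have "det A = det A3"
  proof -
    have "det A3 = det A2"
      unfolding A3_def using pm by (intro det_addcol[where n = "Suc m"]) auto
    also have "\<dots> = det A1"
      unfolding A2_def using pm by (intro det_addcol[where n = "Suc m"]) auto
    also have "\<dots> = det A"
      unfolding A1_def using pm by (intro det_addrow[where n = "Suc m"]) auto
    finally show ?thesis ..
  qed
  also have "\<dots> = (\<Sum>i<Suc m. A3 $$ (i, m) * cofactor A3 i m)"
    by (rule laplace_expansion_column) simp_all
  \<comment> \<open>After column \<open>p\<close> is subtracted, the entries above the corner are
    all \<open>w\<close>, and \<open>w\<close> times the column of ones clears them. The corner is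
    \<open>-w\<close> after the row operation and \<open>-2w\<close> after the first column
    operation. The last operation leaves it alone, since row \<open>m\<close> now starts with
    0.\<close>
  also have "A3 $$ (i, m) = 0" if "i < m" for i
    using that p(1) pm mem[OF that] mem[OF pm]
    by (simp add: A3_def A2_def A1_def A nth sym sym' step)
  hence "(\<Sum>i<Suc m. A3 $$ (i, m) * cofactor A3 i m) = A3 $$ (m, m) * cofactor A3 m m"
    by simp
  also have "A3 $$ (m, m) = - 2 * w"
    using p(1) pm mem[OF pm]
    by (simp add: A3_def A2_def A1_def A nth sym step diag algebra_simps)
  also have "cofactor A3 m m = det (bordered_mat D ys)"
  proof -
    \<comment> \<open>The three operations alter only row \<open>m\<close> and column
      \<open>m\<close>, which are the ones deleted.\<close>
    have "mat_delete A3 m m = bordered_mat D ys"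
    proof (intro eq_matI)
      fix i j assume "i < dim_row (bordered_mat D ys)" "j < dim_col (bordered_mat D ys)"
      hence "i < m" "j < m" by (simp_all add: bordered_mat_def m_def)
      thus "mat_delete A3 m m $$ (i, j) = bordered_mat D ys $$ (i, j)"
        by (simp add: mat_delete_def A3_def A2_def A1_def A nth)
           (auto simp: bordered_mat_def m_def)
    qed (simp_all add: mat_delete_def bordered_mat_def m_def)
    thus ?thesis by (simp add: cofactor_def)
  qed
  finally show ?thesis by (simp add: A_def)
qed

lemma det_bordered_mat_pair:
  "det (bordered_mat D [b, y]) = D y y - D b y"
proof -
  have "bordered_mat D [b, y] \<in> carrier_mat 2 2"
    by (simp add: bordered_mat_def numeral_2_eq_2)
  thus ?thesis
    by (subst laplace_expansion_column[of _ 2 0])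
       (auto simp: bordered_mat_def cofactor_def mat_delete_def det_single lessThan_Suc eval_nat_numeral)
qed

section \<open>Paths in trees\<close>

lemma path_edges_singleton [simp]: "path_edges [u] = {}"
  by (simp add: path_edges_def)

lemma path_edges_Cons:
  assumes "p \<noteq> []"
  shows "path_edges (x # p) = insert {x, hd p} (path_edges p)"
proof -
  have edges: "path_edges q = (\<lambda>i. {q ! i, q ! Suc i}) ` {i. Suc i < length q}" for q :: "'a list"
    by (auto simp: path_edges_def)
  have "{i. Suc i < length (x # p)} = insert 0 (Suc ` {i. Suc i < length p})"
  proof (rule Set.set_eqI)
    show "i \<in> {i. Suc i < length (x # p)} \<longleftrightarrow> i \<in> insert 0 (Suc ` {i. Suc i < length p})" for i
      using assms by (cases i) auto
  qed
  thus ?thesis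
    using assms by (simp only: edges image_insert image_image) (simp add: hd_conv_nth)
qed

lemma path_edges_subset: "e \<in> path_edges p \<Longrightarrow> e \<subseteq> set p"
  by (auto simp: path_edges_def)

lemma finite_path_edges: "finite (path_edges p)"
  by (rule finite_subset[of _ "Pow (set p)"]) (auto dest: path_edges_subset)

lemma path_edges_rev: "path_edges (rev p) = path_edges p"
proof -
  have sub: "path_edges (rev p) \<subseteq> path_edges p" for p :: "'a list"
  proof
    fix e assume "e \<in> path_edges (rev p)"
    then obtain i where i: "Suc i < length p" "e = {rev p ! i, rev p ! Suc i}"
      by (auto simp: path_edges_def)
    define k where "k = length p - Suc (Suc i)"
    have "rev p ! Suc i = p ! k" "rev p ! i = p ! Suc k" "Suc k < length p"
      using i by (simp_all add: rev_nth k_def Suc_diff_Suc)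
    with i show "e \<in> path_edges p" by (auto simp: path_edges_def insert_commute)
  qed
  from sub[of p] sub[of "rev p"] show ?thesis by simp
qed

lemma is_path_singleton: "u \<in> V \<Longrightarrow> is_path V E u u [u]"
  by (simp add: is_path_def)

lemma is_path_Cons:
  assumes "is_path V E u v p" "t \<in> V" "t \<notin> set p" "{t, u} \<in> E"
  shows "is_path V E t v (t # p)"
  using assms by (auto simp: is_path_def successively_Cons)

lemma is_path_rev: "is_path V E u v p \<Longrightarrow> is_path V E v u (rev p)"
  by (auto simp: is_path_def hd_rev last_rev insert_commute)

text \<open>Induction strips the common beginning. Where two paths part, their tails must meet
  again, because both end in \<open>v\<close>; the stretches up to that meeting form a
  cycle.\<close>

lemma acyclic_paths_unique:
  assumes acyc: "\<nexists>c. is_cycle V E c"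
  shows "is_path V E u v p \<Longrightarrow> is_path V E u v q \<Longrightarrow> p = q"
proof (induction p arbitrary: u q)
  case Nil
  thus ?case by (simp add: is_path_def)
next
  case (Cons u' p)
  from Cons.prems have [simp]: "u' = u" by (simp add: is_path_def)
  from Cons.prems obtain q' where q: "q = u # q'"
    by (cases q) (auto simp: is_path_def)
  show ?case
  proof (cases "p = [] \<or> q' = []")
    case True
    with Cons.prems q show ?thesis
      by (auto simp: is_path_def split: if_splits)
  next
    case False
    hence p: "is_path V E (hd p) v p" "u \<notin> set p" "{u, hd p} \<in> E"
      and q': "is_path V E (hd q') v q'" "u \<notin> set q'" "{u, hd q'} \<in> E" "u \<in> V"
      using Cons.prems q by (auto simp: is_path_def successively_Cons)
    show ?thesis
    proof (cases "hd p = hd q'")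
      case True
      with Cons.IH p q' q show ?thesis by simp
    next
      case neq: False
      have "\<exists>z\<in>set p. z \<in> set q'"
        using False p q' by (metis is_path_def last_in_set)
      \<comment> \<open>Taking the first vertex of \<open>p\<close> that lies on \<open>q'\<close>
        keeps \<open>p1\<close> disjoint from \<open>q1\<close>, so the cycle repeats no
        vertex.\<close>
      then obtain p1 z p2 where p1: "p = p1 @ z # p2" "z \<in> set q'" "\<forall>y\<in>set p1. y \<notin> set q'"
        by (rule split_list_first_propE)
      from p1(2) obtain q1 q2 where q1: "q' = q1 @ z # q2"
        by (meson split_list)
      let ?c = "u # p1 @ z # rev q1"
      \<comment> \<open>If \<open>p1\<close> and \<open>q1\<close> were both empty, \<open>z\<close>
        would be the head of both tails, contrary to \<open>neq\<close>.\<close>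
      have len: "length ?c \<ge> 3"
        using neq p1 q1 by (cases p1; cases q1) auto
      have dist: "distinct ?c"
        using p q' p1 q1 by (auto simp: is_path_def)
      have sub: "set ?c \<subseteq> V"
        using p q' p1 q1 by (auto simp: is_path_def)
      have "successively (\<lambda>a b. {a, b} \<in> E) (u # p1 @ [z])"
        using p p1 by (cases p1) (auto simp: is_path_def successively_append_iff successively_Cons hd_append split: if_splits)
      moreover have "successively (\<lambda>a b. {a, b} \<in> E) (z # rev q1)"
      proof -
        have "successively (\<lambda>a b. {a, b} \<in> E) (q1 @ [z])"
          using q' q1 by (auto simp: is_path_def successively_append_iff successively_Cons)
        hence "successively (\<lambda>a b. {b, a} \<in> E) (q1 @ [z])"
          by (simp add: insert_commute)
        hence "successively (\<lambda>a b. {a, b} \<in> E) (rev (q1 @ [z]))"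
          by (simp only: successively_rev)
        thus ?thesis by simp
      qed
      ultimately have succ: "successively (\<lambda>a b. {a, b} \<in> E) ?c"
        by (auto simp: successively_append_iff successively_Cons hd_append)
      have "{last ?c, hd ?c} \<in> E"
        using q' q1 by (cases q1) (auto simp: insert_commute last_rev)
      with len dist sub succ have "is_cycle V E ?c"
        by (simp add: is_cycle_def)
      with acyc show ?thesis by blast
    qed
  qed
qed

section \<open>Weighted distances in a tree\<close>

locale tree =
  fixes V :: "'a set" and E :: "'a set set"
  assumes tree: "is_tree V E"
begin

lemma edge_subset: "e \<in> E \<Longrightarrow> e \<subseteq> V"
  using tree by (auto simp: is_tree_def simple_graph_def)

lemma card_edge: "e \<in> E \<Longrightarrow> card e = 2"
  using tree by (auto simp: is_tree_def simple_graph_def)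

lemma edge_pairE:
  assumes "e \<in> E" "t \<in> e"
  obtains s where "e = {s, t}" "s \<in> V" "s \<noteq> t"
  using card_edge[OF assms(1)] edge_subset[OF assms(1)] assms(2)
  by (auto simp: card_2_iff doubleton_eq_iff)

lemma finite_edges: "finite E"
proof (rule finite_subset)
  show "E \<subseteq> Pow V" using edge_subset by blast
  show "finite (Pow V)" using tree by (simp add: is_tree_def simple_graph_def)
qed

lemma pathE:
  assumes "u \<in> V" "v \<in> V"
  obtains p where "is_path V E u v p"
  using tree assms unfolding is_tree_def by blast

lemma path_unique: "is_path V E u v p \<Longrightarrow> is_path V E u v q \<Longrightarrow> p = q"
  using tree acyclic_paths_unique unfolding is_tree_def by metis

lemma wdist_path:
  assumes "is_path V E u v p"
  shows "wdist V E w u v = (\<Sum>e\<in>path_edges p. w e)"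
proof -
  have "(THE p. is_path V E u v p) = p"
    using assms path_unique by blast
  thus ?thesis by (simp add: wdist_def)
qed

lemma wdist_refl: "u \<in> V \<Longrightarrow> wdist V E w u u = 0"
  using wdist_path[OF is_path_singleton] by simp

lemma wdist_commute:
  assumes "u \<in> V" "v \<in> V"
  shows "wdist V E w u v = wdist V E w v u"
proof -
  obtain p where "is_path V E u v p" using pathE[OF assms] .
  thus ?thesis
    using wdist_path is_path_rev path_edges_rev by metis
qed

lemma wdist_step:
  assumes "is_path V E s y p" "t \<notin> set p" "{s, t} \<in> E"
  shows "wdist V E w t y = wdist V E w s y + w {s, t}"
proof -
  have "p \<noteq> []" "hd p = s" using assms by (auto simp: is_path_def)
  moreover have "is_path V E t y (t # p)"
    using assms edge_subset[OF assms(3)] by (intro is_path_Cons) (auto simp: insert_commute)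
  moreover have "{t, s} \<notin> path_edges p"
    using assms path_edges_subset by blast
  ultimately show ?thesis
    using assms by (simp add: wdist_path path_edges_Cons finite_path_edges insert_commute)
qed

section \<open>Subtrees, encoded as path-closed vertex sets, and their growth by one leaf\<close>

definition convex :: "'a set \<Rightarrow> bool" where
  "convex S \<longleftrightarrow> (\<forall>s\<in>S. \<forall>y\<in>S. \<forall>p. is_path V E s y p \<longrightarrow> set p \<subseteq> S)"

text \<open>The path from \<open>s\<close> to \<open>y\<close> stays in \<open>S\<close>, hence
  avoids \<open>t\<close> and can be prolonged by the edge to \<open>t\<close>.\<close>

lemma wdist_step_convex:
  assumes "convex S" "S \<subseteq> V" "s \<in> S" "t \<notin> S" "{s, t} \<in> E" "y \<in> S"
  shows "wdist V E w t y = wdist V E w s y + w {s, t}"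
proof -
  obtain p where p: "is_path V E s y p" using pathE assms by blast
  hence "t \<notin> set p" using assms by (auto simp: convex_def)
  with p assms show ?thesis by (intro wdist_step)
qed

text \<open>By uniqueness, every path from \<open>t\<close> into \<open>S\<close> begins with the
  edge to \<open>s\<close> and then stays in \<open>S\<close>.\<close>

lemma convex_insert:
  assumes S: "convex S" "S \<subseteq> V" "s \<in> S" "t \<notin> S" "{s, t} \<in> E"
  shows "convex (insert t S)"
proof -
  have t: "t \<in> V" using edge_subset[OF S(5)] by simp
  have out: "set q \<subseteq> insert t S" if q: "is_path V E t y q" and y: "y \<in> S" for y q
  proof -
    obtain p where p: "is_path V E s y p" using pathE S y by blast
    hence pS: "set p \<subseteq> S" using S y by (auto simp: convex_def)
    have "is_path V E t y (t # p)"
      using p pS S t by (intro is_path_Cons) (auto simp: insert_commute)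
    with q have "q = t # p" by (rule path_unique)
    with pS show ?thesis by auto
  qed
  show ?thesis unfolding convex_def
  proof (intro ballI allI impI)
    fix y z p assume yz: "y \<in> insert t S" "z \<in> insert t S" and p: "is_path V E y z p"
    consider "y \<in> S" "z \<in> S" | "y = t" "z \<in> S" | "y \<in> S" "z = t" | "y = t" "z = t"
      using yz by blast
    thus "set p \<subseteq> insert t S"
    proof cases
      case 1 with S p show ?thesis by (auto simp: convex_def)
    next
      case 2 with out p show ?thesis by blast
    next
      case 3 with out[OF is_path_rev] p show ?thesis by fastforce
    next
      case 4
      with p path_unique[OF _ is_path_singleton[OF t]] show ?thesis by fastforce
    qed
  qed
qed

text \<open>A second edge from \<open>t\<close> to some \<open>y\<close> in \<open>S\<close> would
  be a path competing with the one through \<open>s\<close>. Thus each attached vertex contributes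
  exactly one factor to the product of weights.\<close>

lemma edges_insert_convex:
  assumes S: "convex S" "S \<subseteq> V" "s \<in> S" "t \<notin> S" "{s, t} \<in> E"
  shows "{e \<in> E. e \<subseteq> insert t S} = insert {s, t} {e \<in> E. e \<subseteq> S}"
proof -
  have t: "t \<in> V" using edge_subset[OF S(5)] by simp
  have "e = {s, t}" if e: "e \<in> E" "e \<subseteq> insert t S" "\<not> e \<subseteq> S" for e
  proof -
    have "t \<in> e" using e by blast
    then obtain y where y: "e = {y, t}" "y \<in> V" "y \<noteq> t"
      using edge_pairE[OF e(1)] by metis
    with e have yS: "y \<in> S" by auto
    obtain p where p: "is_path V E s y p" using pathE S y by blast
    hence pS: "set p \<subseteq> S" using S yS by (auto simp: convex_def)
    have "is_path V E t y (t # p)"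
      using p pS S t by (intro is_path_Cons) (auto simp: insert_commute)
    moreover have "is_path V E t y (t # [y])"
      using y e t by (intro is_path_Cons[OF is_path_singleton]) (auto simp: insert_commute)
    ultimately have "p = [y]" using path_unique by fastforce
    with p have "s = y" by (simp add: is_path_def)
    with y show ?thesis by simp
  qed
  moreover have "{s, t} \<subseteq> insert t S" using S(3) by simp
  ultimately show ?thesis using S(5) by blast
qed

section \<open>Enumerations of a tree by successive attachment\<close>

text \<open>Read backwards, such a list strips off leaf after leaf until only \<open>b\<close>
  remains. Every nonempty prefix spans a subtree, which is why the parent \<open>s\<close> is unique
  without being required to be.\<close>

inductive leaf_order :: "'a \<Rightarrow> 'a list \<Rightarrow> bool" for b where
  start: "b \<in> V \<Longrightarrow> leaf_order b [b]"
| attach: "leaf_order b ys \<Longrightarrow> s \<in> set ys \<Longrightarrow> t \<notin> set ys \<Longrightarrow> {s, t} \<in> E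
     \<Longrightarrow> leaf_order b (ys @ [t])"

lemma leaf_order_basics:
  assumes "leaf_order b ys"
  shows "ys \<noteq> []" "hd ys = b" "distinct ys" "set ys \<subseteq> V"
proof -
  have "ys \<noteq> [] \<and> hd ys = b \<and> distinct ys \<and> set ys \<subseteq> V"
    using assms by induction (use edge_subset in auto)
  thus "ys \<noteq> []" "hd ys = b" "distinct ys" "set ys \<subseteq> V" by auto
qed

lemma leaf_order_convex: "leaf_order b ys \<Longrightarrow> convex (set ys)"
proof (induction rule: leaf_order.induct)
  case start
  thus ?case
    using path_unique[OF _ is_path_singleton] by (fastforce simp: convex_def)
next
  case (attach ys s t)
  thus ?case
    using convex_insert leaf_order_basics by simp
qed

lemma leaf_order_root_neighbour:
  assumes "leaf_order b ys" "length ys \<ge> 2"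
  shows "\<exists>t\<in>set ys. {b, t} \<in> E"
  using assms
proof (induction rule: leaf_order.induct)
  case (attach ys s t)
  show ?case
  proof (cases "length ys \<ge> 2")
    case False
    with leaf_order_basics[OF attach.hyps(1)] have "ys = [b]"
      by (cases ys) (auto simp: not_le less_Suc_eq)
    with attach.hyps show ?thesis by auto
  qed (use attach in auto)
qed simp

lemma leaf_edge_unique:
  assumes "is_leaf V E b" "e \<in> E" "b \<in> e" "e' \<in> E" "b \<in> e'"
  shows "e = e'"
proof -
  from assms(1) obtain f where "{e \<in> E. b \<in> e} = {f}"
    by (auto simp: is_leaf_def card_1_singleton_iff)
  moreover have "e \<in> {e \<in> E. b \<in> e}" "e' \<in> {e \<in> E. b \<in> e}"
    using assms by simp_all
  ultimately show ?thesis by simp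
qed

text \<open>The only edge at the leaf \<open>b\<close> already leads to the second vertex of the
  list, so nothing further can hang on \<open>b\<close>.\<close>

lemma leaf_order_parent_ne_root:
  assumes "leaf_order b ys" "is_leaf V E b" "length ys \<ge> 2" "t \<notin> set ys" "{s, t} \<in> E"
  shows "s \<noteq> b"
proof
  assume "s = b"
  obtain y where y: "y \<in> set ys" "{b, y} \<in> E"
    using leaf_order_root_neighbour[OF assms(1,3)] by blast
  have "{b, t} = {b, y}"
    using assms(5) y(2) \<open>s = b\<close> by (intro leaf_edge_unique[OF assms(2)]) auto
  hence "t = y" by (auto simp: doubleton_eq_iff)
  with y assms(4) show False by simp
qed

lemma leaf_order_parent_index:
  assumes "leaf_order b ys" "is_leaf V E b" "length ys \<ge> 2" "s \<in> set ys" "t \<notin> set ys" "{s, t} \<in> E"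
  obtains p where "0 < p" "p < length ys" "ys ! p = s"
proof -
  from assms(4) obtain p where p: "p < length ys" "ys ! p = s"
    by (auto simp: in_set_conv_nth)
  moreover have "p \<noteq> 0"
    using leaf_order_parent_ne_root[OF assms(1-3,5,6)] leaf_order_basics(1,2)[OF assms(1)] p
    by (intro notI) (simp add: hd_conv_nth)
  ultimately show ?thesis using that by simp
qed

text \<open>An inner vertex of a path has two distinct neighbours on it, hence lies on two
  edges.\<close>

lemma leaf_not_inner:
  assumes "is_leaf V E a" "is_path V E u v p" "a \<noteq> u" "a \<noteq> v"
  shows "a \<notin> set p"
proof
  assume "a \<in> set p"
  then obtain p1 p2 where p: "p = p1 @ a # p2" by (meson split_list)
  with assms have "p1 \<noteq> []" "p2 \<noteq> []" by (auto simp: is_path_def)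
  hence "last p1 \<in> set p1" "hd p2 \<in> set p2" by auto
  with p assms(2) have ne: "last p1 \<noteq> hd p2" "last p1 \<noteq> a"
    by (auto simp: is_path_def)
  have "{last p1, a} \<in> E" "{a, hd p2} \<in> E"
    using p assms(2) \<open>p1 \<noteq> []\<close> \<open>p2 \<noteq> []\<close>
    by (auto simp: is_path_def successively_append_iff successively_Cons)
  hence "{last p1, a} = {a, hd p2}"
    by (intro leaf_edge_unique[OF assms(1)]) auto
  with ne show False by (auto simp: doubleton_eq_iff)
qed

text \<open>The crossing edge is found on the path itself. Keeping \<open>t\<close> on the path lets
  a path that avoids a vertex yield a \<open>t\<close> different from it.\<close>

lemma path_exits:
  assumes "is_path V E u v p" "u \<in> S" "v \<notin> S"
  shows "\<exists>s\<in>S. \<exists>t\<in>set p - S. {s, t} \<in> E"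
  using assms
proof (induction p arbitrary: u)
  case (Cons x p)
  hence "x = u" "p \<noteq> []" by (auto simp: is_path_def split: if_splits)
  with Cons.prems have *: "is_path V E (hd p) v p" "{u, hd p} \<in> E"
    by (auto simp: is_path_def successively_Cons)
  show ?case
  proof (cases "hd p \<in> S")
    case True
    with Cons.IH[OF *(1)] Cons.prems show ?thesis by auto
  next
    case False
    with * Cons.prems \<open>p \<noteq> []\<close> show ?thesis by force
  qed
qed (simp add: is_path_def)

text \<open>A longest enumeration avoiding \<open>a\<close> misses nothing else: the path from
  \<open>b\<close> to a missed vertex avoids the leaf \<open>a\<close>, and the edge by which it
  leaves the list would extend the enumeration.\<close>

lemma leaf_order_exists:
  assumes a: "is_leaf V E a" and b: "b \<in> V" "b \<noteq> a"
  obtains ys where "leaf_order b ys" "set ys = V - {a}"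
proof -
  have fin: "finite V" using tree by (simp add: is_tree_def simple_graph_def)
  define P where "P ys \<longleftrightarrow> leaf_order b ys \<and> a \<notin> set ys" for ys
  have "P [b]" using b by (auto simp: P_def intro: start)
  moreover have "\<forall>ys. P ys \<longrightarrow> length ys < Suc (card V)"
  proof (intro allI impI)
    fix ys assume "P ys"
    hence "distinct ys" "set ys \<subseteq> V"
      using leaf_order_basics(3,4)[of b ys] by (auto simp: P_def)
    thus "length ys < Suc (card V)"
      using card_mono[OF fin, of "set ys"] distinct_card[of ys] by simp
  qed
  ultimately obtain ys where ys: "P ys" "\<And>zs. P zs \<Longrightarrow> length zs \<le> length ys"
    using ex_has_greatest_nat[of P "[b]" length "Suc (card V)"] by auto
  have lo: "leaf_order b ys" "a \<notin> set ys" using ys by (auto simp: P_def)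
  have "set ys = V - {a}"
  proof (rule ccontr)
    assume "set ys \<noteq> V - {a}"
    with leaf_order_basics[OF lo(1)] lo obtain z where z: "z \<in> V" "z \<noteq> a" "z \<notin> set ys"
      by blast
    obtain p where p: "is_path V E b z p" using pathE b z by blast
    have "a \<notin> set p" using leaf_not_inner[OF a p] b z by auto
    moreover have "b \<in> set ys" using leaf_order_basics[OF lo(1)] by auto
    ultimately obtain s t where "s \<in> set ys" "t \<notin> set ys" "t \<noteq> a" "{s, t} \<in> E"
      using path_exits[OF p, of "set ys"] z by fastforce
    hence "P (ys @ [t])" using lo by (auto simp: P_def intro: attach)
    from ys(2)[OF this] show False by simp
  qed
  with lo that show ?thesis by blast
qed

text \<open>Every attachment contributes \<open>-2w\<close>, except the first, which contributes
  \<open>-w\<close>. This explains the exponent of 2 being one less than that of the sign.\<close>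

lemma det_bordered_leaf_order:
  fixes x :: "'r :: comm_ring_1"
  assumes "leaf_order b ys" "is_leaf V E b" "length ys \<ge> 2"
  shows "det (bordered_mat (\<lambda>y z. x + of_int (wdist V E w y z)) ys)
       = (- 1) ^ (length ys - 1) * 2 ^ (length ys - 2) * of_int (\<Prod>e | e \<in> E \<and> e \<subseteq> set ys. w e)"
  using assms
proof (induction rule: leaf_order.induct)
  case (attach ys s t)
  let ?D = "\<lambda>y z. x + of_int (wdist V E w y z) :: 'r"
  note ys = leaf_order_basics[OF attach.hyps(1)] leaf_order_convex[OF attach.hyps(1)]
  have t: "t \<in> V" using edge_subset[OF attach.hyps(4)] by simp
  have step: "?D t y = ?D s y + of_int (w {s, t})" if "y \<in> set ys" for y
    using wdist_step_convex[OF ys(5,4) attach.hyps(2-4) that] by simp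
  have notin: "{s, t} \<notin> {e \<in> E. e \<subseteq> set ys}" using attach.hyps by auto
  have prod: "(\<Prod>e | e \<in> E \<and> e \<subseteq> set (ys @ [t]). w e)
      = w {s, t} * (\<Prod>e | e \<in> E \<and> e \<subseteq> set ys. w e)"
    using edges_insert_convex[OF ys(5,4) attach.hyps(2-4)] notin finite_edges by simp
  show ?case
  proof (cases "length ys \<ge> 2")
    case False
    with ys(1,2) have [simp]: "ys = [b]"
      by (cases ys) (auto simp: not_le less_Suc_eq)
    \<comment> \<open>The first attachment joins \<open>t\<close> to \<open>b\<close> itself: the
      determinant is \<open>x - (x + w) = -w\<close>, and the product over the edges inside
      \<open>{b}\<close> is empty.\<close>
    have "{e \<in> E. e \<subseteq> {b}} = {}"
      using card_edge[of "{}"] card_edge[of "{b}"] by (auto simp: subset_singleton_iff)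
    with prod step[of b] wdist_refl wdist_commute[of b t] ys t attach.hyps(2) show ?thesis
      by (simp add: det_bordered_mat_pair)
  next
    case True
    obtain p where p: "0 < p" "p < length ys" "ys ! p = s"
      using leaf_order_parent_index[OF attach.hyps(1) attach.prems(1) True attach.hyps(2-4)] .
    have comm: "?D y z = ?D z y" if "y \<in> V" "z \<in> V" for y z
      using wdist_commute[OF that] by simp
    have "det (bordered_mat ?D (ys @ [t])) = - 2 * of_int (w {s, t}) * det (bordered_mat ?D ys)"
    proof (rule det_bordered_mat_snoc[OF p(1,2)], unfold p(3))
      show "?D y t = ?D t y" if "y \<in> set ys" for y
        using ys(4) t that by (intro comm) auto
      show "?D y s = ?D s y" if "y \<in> set ys" for y
        using ys(4) attach.hyps(2) that by (intro comm) auto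
      show "?D t t = ?D s s"
        using ys(4) t attach.hyps(2) by (auto simp: wdist_refl)
    qed (rule step)
    moreover obtain m where "length ys = Suc (Suc m)"
      using True by (auto simp: le_iff_add)
    ultimately show ?thesis
      using attach.IH[OF attach.prems(1) True] prod by (simp add: mult_ac)
  qed
qed simp

end

section \<open>Reduction of the shifted distance matrix to the bordered matrix\<close>

theorem corollary1p1:
  fixes V :: "'a set" and E :: "'a set set" and v :: "nat \<Rightarrow> 'a"
    and w :: "'a set \<Rightarrow> int" and n :: nat
  assumes "n > 1"
    and "is_tree V E"
    and "bij_betw v {1..n + 1} V"
    and "is_leaf V E (v 1)"
    and "is_leaf V E (v (n + 1))"
  shows "det (shifted_dist_mat V E w v n) = of_int (2 ^ (n - 2) * (\<Prod>e\<in>E. w e))"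
proof -
  interpret tree V E by unfold_locales fact
  define a b where "a = v 1" and "b = v (n + 1)"
  define D :: "'a \<Rightarrow> 'a \<Rightarrow> int poly" where "D y z = [:0, 1:] + of_int (wdist V E w y z)" for y z
  \<comment> \<open>Rows are indexed by all vertices but \<open>a\<close>, columns by all but
    \<open>b\<close>. Letting the label \<open>b\<close> stand for the column of \<open>a\<close>
    gives both the index set \<open>V - {a}\<close>, as \<open>det_reindex\<close> demands.\<close>
  define f where "f y z = D y (if z = b then a else z)" for y z
  have inj: "v i = v j \<longleftrightarrow> i = j" if "i \<in> {1..n + 1}" "j \<in> {1..n + 1}" for i j
    using assms(3) that by (auto simp: bij_betw_def inj_on_def)
  have a: "is_leaf V E a" "a \<in> V" and b: "is_leaf V E b" "b \<in> V" and "b \<noteq> a"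
    using assms by (auto simp: a_def b_def is_leaf_def inj)
  obtain ys where ys: "leaf_order b ys" "set ys = V - {a}"
    using leaf_order_exists[OF a(1) b(2) \<open>b \<noteq> a\<close>] .
  note ys' = leaf_order_basics[OF ys(1)] leaf_order_convex[OF ys(1)]
  have card: "card V = n + 1"
    using bij_betw_same_card[OF assms(3)] by simp
  have len: "length ys = n"
    using distinct_card[OF ys'(3)] ys(2) card a(2) by simp
  have a_notin: "a \<notin> set ys" using ys by simp
  obtain s where s: "{s, a} \<in> E" "s \<in> set ys"
  proof -
    have "card {e \<in> E. a \<in> e} \<noteq> 0" using a(1) by (simp add: is_leaf_def)
    hence "{e \<in> E. a \<in> e} \<noteq> {}" by (metis card.empty)
    then obtain e where "e \<in> E" "a \<in> e" by blast
    then obtain s where "e = {s, a}" "s \<in> V" "s \<noteq> a" by (rule edge_pairE)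
    with ys that \<open>e \<in> E\<close> show ?thesis by blast
  qed
  \<comment> \<open>Since \<open>n > 1\<close>, the edge at \<open>b\<close> is used up inside
    \<open>ys\<close>, so the neighbour \<open>s\<close> of \<open>a\<close> is not
    \<open>b\<close>.\<close>
  obtain p where p: "0 < p" "p < n" "ys ! p = s"
    using leaf_order_parent_index[OF ys(1) b(1) _ s(2) a_notin s(1)] len assms(1) by auto
  have edges: "E = insert {s, a} {e \<in> E. e \<subseteq> set ys}"
  proof -
    have "{e \<in> E. e \<subseteq> insert a (set ys)} = E"
      using ys(2) edge_subset a(2) by auto
    with edges_insert_convex[OF ys'(5,4) s(2) a_notin s(1)] show ?thesis by simp
  qed
  have "(\<Prod>e\<in>insert {s, a} {e \<in> E. e \<subseteq> set ys}. w e) = w {s, a} * (\<Prod>e | e \<in> E \<and> e \<subseteq> set ys. w e)"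
    using finite_edges a_notin by (intro prod.insert) auto
  hence prod: "(\<Prod>e\<in>E. w e) = w {s, a} * (\<Prod>e | e \<in> E \<and> e \<subseteq> set ys. w e)"
    using edges by simp

  have "det (shifted_dist_mat V E w v n) = det (mat n n (\<lambda>(i, j). D (v (i + 2)) (v (j + 1))))"
    by (simp add: shifted_dist_mat_def D_def)
  also have "\<dots> = (- 1) ^ (n - 1) *
      det (mat n n (\<lambda>(i, j). D (v (i + 2)) (v ((if Suc j = n then 0 else Suc j) + 1))))"
    using assms(1) by (subst det_rotate_cols[where f = "\<lambda>i j. D (v (i + 2)) (v (j + 1))"]) simp_all
  \<comment> \<open>After the rotation column \<open>j\<close> belongs to \<open>v (j + 2)\<close>,
    except that the last one belongs to \<open>a\<close>; there \<open>v (j + 2)\<close> is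
    \<open>b\<close>, which \<open>f\<close> turns into \<open>a\<close>.\<close>
  also have "mat n n (\<lambda>(i, j). D (v (i + 2)) (v ((if Suc j = n then 0 else Suc j) + 1)))
      = mat n n (\<lambda>(i, j). f (v (i + 2)) (v (j + 2)))"
    by (intro eq_matI) (auto simp: f_def a_def b_def inj)
  also have "det \<dots> = det (mat n n (\<lambda>(i, j). f (ys ! i) (ys ! j)))"
  proof (rule det_reindex[where f = f and g = "\<lambda>i. v (i + 2)" and h = "\<lambda>i. ys ! i"])
    show "bij_betw (\<lambda>i. v (i + 2)) {0..<n} (V - {a})"
    proof -
      have "bij_betw v ({1..n + 1} - {1}) (V - {v 1})"
        using assms(3) a(2) by (intro bij_betw_DiffI) (auto simp: a_def)
      moreover have "bij_betw (\<lambda>i. i + 2) {0..<n} ({1..n + 1} - {1})"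
        by (rule bij_betw_byWitness[where f' = "\<lambda>i. i - 2"]) auto
      ultimately show ?thesis
        using bij_betw_trans by (fastforce simp: a_def comp_def)
    qed
    show "bij_betw (\<lambda>i. ys ! i) {0..<n} (V - {a})"
      by (rule bij_betw_nth[OF ys'(3)]) (simp_all add: ys(2) len atLeast0LessThan)
  qed
  also have "det (mat n n (\<lambda>(i, j). f (ys ! i) (ys ! j))) = of_int (w {s, a}) * det (bordered_mat D ys)"
  proof -
    let ?C = "mat n n (\<lambda>(i, j). f (ys ! i) (ys ! j))"
    have ys0: "ys ! i = b \<longleftrightarrow> i = 0" if "i < n" for i
    proof -
      have "b = ys ! 0" using ys'(1,2) by (simp add: hd_conv_nth)
      thus ?thesis using ys'(1,3) that len by (simp add: nth_eq_iff_index_eq)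
    qed
    have *: "D (ys ! i) a = D (ys ! i) s + of_int (w {s, a})" if "i < n" for i
    proof -
      have "ys ! i \<in> set ys" using that len by simp
      thus ?thesis
        using wdist_step_convex[OF ys'(5,4) s(2) a_notin s(1), of "ys ! i" w] ys'(4) s(2) a(2)
        by (auto simp: D_def subset_iff wdist_commute[of "ys ! i"])
    qed
    have "s \<noteq> b" using ys0[OF p(2)] p by simp
    \<comment> \<open>Position 0 carries the column of \<open>a\<close>, and position
      \<open>p\<close> the true column of \<open>s\<close>, as \<open>s\<close> differs from
      \<open>b\<close>. Their difference is constantly \<open>w {s, a}\<close>.\<close>
    have "addcol (- 1) 0 p ?C = multcol 0 (of_int (w {s, a})) (bordered_mat D ys)"
      using p \<open>s \<noteq> b\<close> by (intro eq_matI)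
        (auto simp: mat_addcol_def mat_multcol_def bordered_mat_def len f_def ys0 *)
    moreover have "det (addcol (- 1) 0 p ?C) = det ?C"
      using p by (intro det_addcol) auto
    moreover have "det (multcol 0 (of_int (w {s, a})) (bordered_mat D ys))
        = of_int (w {s, a}) * det (bordered_mat D ys)"
      using assms(1) by (intro det_multcol[of _ n]) (auto simp: bordered_mat_def len)
    ultimately show ?thesis by simp
  qed
  also have "det (bordered_mat D ys)
      = (- 1) ^ (n - 1) * 2 ^ (n - 2) * of_int (\<Prod>e | e \<in> E \<and> e \<subseteq> set ys. w e)"
    using det_bordered_leaf_order[OF ys(1) b(1), of "[:0, 1:]" w] len assms(1)
    by (simp add: D_def[abs_def])
  \<comment> \<open>The sign of the rotation cancels the sign of the bordered determinant.\<close>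
  finally show ?thesis
    by (simp add: prod mult_ac flip: power_add power_mult_distrib)
qed

end
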